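(* For any star $S$ and any $n$-vertex graph $H$, $$\mathrm{gm}(S\cdot H)\leq 2\sqrt{n( \mathrm{tw}(H) +1)}.$$
   Context: For a graph $G$, $\mathrm{gm}(G)$ is the maximum integer $k$ such that the $k\times k$ grid is a minor of $G$, and $\mathrm{tw}(G)$ is the treewidth of $G$. $G_1\cdot G_2$ denotes the lexicographic product: vertex set $V(G_1)\times V(G_2)$, where distinct $(u_1,u_2),(v_1,v_2)$ are adjacent iff $u_1v_1\in E(G_1)$, or $u_1=v_1$ and $u_2v_2\in E(G_2)$. *)

theory Defs
  imports Complex_Main "Graph_Theory.Digraph_Component"
begin

text \<open>
  Finite simple graphs are modelled by the locale \<^locale>\<open>pair_graph\<close>: a finite vertex set with a
  symmetric, loop-free set of arcs, so that an edge \<open>uv\<close> is the pair of arcs \<open>(u, v)\<close>, \<open>(v, u)\<close>.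
\<close>

definition induces_connected :: "'a pair_pre_digraph \<Rightarrow> 'a set \<Rightarrow> bool" where
  "induces_connected G A \<longleftrightarrow>
     A \<subseteq> pverts G \<and> Digraph_Component.connected (with_proj G \<restriction> A)"

text \<open>
  The library's \<^const>\<open>tree\<close> does not fit symmetric digraphs: there \<open>a, b, a\<close> counts as a cycle.
  A cycle of the underlying undirected graph is a directed cycle of length at least 3.
\<close>

definition graph_tree :: "'a pair_pre_digraph \<Rightarrow> bool" where
  "graph_tree T \<longleftrightarrow>
     pair_graph T \<and> Digraph_Component.connected (with_proj T) \<and>
     \<not> (\<exists>p. pre_digraph.cycle (with_proj T) p \<and> length p \<ge> 3)"

definition tree_decomposition ::
    "'a pair_pre_digraph \<Rightarrow> 't pair_pre_digraph \<Rightarrow> ('t \<Rightarrow> 'a set) \<Rightarrow> bool" where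
  "tree_decomposition G T B \<longleftrightarrow>
     graph_tree T \<and>
     (\<forall>t \<in> pverts T. B t \<subseteq> pverts G) \<and>
     (\<forall>(u, v) \<in> parcs G. \<exists>t \<in> pverts T. u \<in> B t \<and> v \<in> B t) \<and>
     (\<forall>v \<in> pverts G. induces_connected T {t \<in> pverts T. v \<in> B t})"

definition decomposition_width :: "'t pair_pre_digraph \<Rightarrow> ('t \<Rightarrow> 'a set) \<Rightarrow> int" where
  "decomposition_width T B = int (Max ((\<lambda>t. card (B t)) ` pverts T)) - 1"

text \<open>
  Every finite tree is isomorphic to one whose nodes are natural numbers, so it suffices to let the
  decomposition trees range over such trees. The graph without vertices has treewidth \<open>-1\<close>.
\<close>

definition treewidth :: "'a pair_pre_digraph \<Rightarrow> int" where
  "treewidth G = Inf {decomposition_width T B | (T :: nat pair_pre_digraph) B.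
                        tree_decomposition G T B}"

text \<open>\<open>M v\<close> is the branch set of the vertex \<open>v\<close> of the minor; connected graphs are non-empty.\<close>

definition is_minor :: "'b pair_pre_digraph \<Rightarrow> 'a pair_pre_digraph \<Rightarrow> bool" where
  "is_minor H G \<longleftrightarrow>
     (\<exists>M :: 'b \<Rightarrow> 'a set.
        (\<forall>v \<in> pverts H. induces_connected G (M v)) \<and>
        (\<forall>u \<in> pverts H. \<forall>v \<in> pverts H. u \<noteq> v \<longrightarrow> M u \<inter> M v = {}) \<and>
        (\<forall>(u, v) \<in> parcs H. \<exists>x \<in> M u. \<exists>y \<in> M v. (x, y) \<in> parcs G))"

definition grid :: "nat \<Rightarrow> (nat \<times> nat) pair_pre_digraph" where
  "grid k = \<lparr> pverts = {..<k} \<times> {..<k},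
     parcs = {((i, j), (i', j')). i < k \<and> j < k \<and> i' < k \<and> j' < k \<and>
       (i = i' \<and> (j' = Suc j \<or> j = Suc j') \<or> j = j' \<and> (i' = Suc i \<or> i = Suc i'))} \<rparr>"

definition gm :: "'a pair_pre_digraph \<Rightarrow> nat" where
  "gm G = Max {k. is_minor (grid k) G}"

definition lex_product ::
    "'a pair_pre_digraph \<Rightarrow> 'b pair_pre_digraph \<Rightarrow> ('a \<times> 'b) pair_pre_digraph" where
  "lex_product G H = \<lparr> pverts = pverts G \<times> pverts H,
     parcs = {((u\<^sub>1, u\<^sub>2), (v\<^sub>1, v\<^sub>2)).
       (u\<^sub>1, u\<^sub>2) \<in> pverts G \<times> pverts H \<and> (v\<^sub>1, v\<^sub>2) \<in> pverts G \<times> pverts H \<and>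
       (u\<^sub>1, u\<^sub>2) \<noteq> (v\<^sub>1, v\<^sub>2) \<and>
       ((u\<^sub>1, v\<^sub>1) \<in> parcs G \<or> u\<^sub>1 = v\<^sub>1 \<and> (u\<^sub>2, v\<^sub>2) \<in> parcs H)} \<rparr>"

text \<open>A star is \<open>K\<^bsub>1,m\<^esub>\<close> with \<open>m \<ge> 0\<close> leaves.\<close>

definition star :: "'a pair_pre_digraph \<Rightarrow> bool" where
  "star S \<longleftrightarrow> pair_graph S \<and>
     (\<exists>c \<in> pverts S. parcs S = {c} \<times> (pverts S - {c}) \<union> (pverts S - {c}) \<times> {c})"

lemma pair_graph_grid: "pair_graph (grid k)"
proof -
  have "finite (parcs (grid k))"
    by (rule finite_subset[of _ "({..<k} \<times> {..<k}) \<times> ({..<k} \<times> {..<k})"]) (auto simp: grid_def)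
  then show ?thesis
    by unfold_locales (auto simp: grid_def symmetric_def intro!: symI)
qed

lemma pair_graph_lex_product:
  assumes "pair_graph G" "pair_graph H"
  shows "pair_graph (lex_product G H)"
proof -
  interpret G: pair_graph G by fact
  interpret H: pair_graph H by fact
  let ?P = "lex_product G H"
  have verts: "finite (pverts ?P)"
    by (simp add: lex_product_def)
  have sub: "parcs ?P \<subseteq> pverts ?P \<times> pverts ?P"
    by (auto simp: lex_product_def)
  have "sym (parcs ?P)"
    unfolding lex_product_def by (rule symI) (auto intro: G.arcs_symmetric H.arcs_symmetric)
  moreover have "fst e \<noteq> snd e" if "e \<in> parcs ?P" for e
    using that by (auto simp: lex_product_def)
  moreover have "finite (parcs ?P)"
    using finite_subset[OF sub] verts by blast
  moreover have "fst e \<in> pverts ?P" "snd e \<in> pverts ?P" if "e \<in> parcs ?P" for e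
    using sub that by auto
  ultimately show ?thesis
    using verts by unfold_locales (simp_all add: symmetric_def)
qed

lemma connected_nonempty:
  "induces_connected G A \<Longrightarrow> A \<noteq> {}"
  by (auto simp: induces_connected_def Digraph_Component.connected_def strongly_connected_def
      mk_symmetric_def)

lemma is_minor_card_le:
  assumes "pair_graph G" "finite (pverts H)" "is_minor H G"
  shows "card (pverts H) \<le> card (pverts G)"
proof -
  interpret G: pair_graph G by fact
  obtain M where M: "\<forall>v \<in> pverts H. induces_connected G (M v)"
    and d: "\<forall>u \<in> pverts H. \<forall>v \<in> pverts H. u \<noteq> v \<longrightarrow> M u \<inter> M v = {}"
    using assms(3) unfolding is_minor_def by blast
  define f where "f v = (SOME x. x \<in> M v)" for v
  have f: "f v \<in> M v" if "v \<in> pverts H" for v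
    unfolding f_def using M that connected_nonempty by (metis some_in_eq)
  have "inj_on f (pverts H)"
    using d f by (intro inj_onI) (metis disjoint_iff)
  moreover have "f ` pverts H \<subseteq> pverts G"
    using M f by (auto simp: induces_connected_def)
  ultimately show ?thesis
    using card_inj_on_le G.pair_finite_verts by blast
qed

lemma gm_attained:
  assumes "pair_graph G"
  shows "finite {k. is_minor (grid k) G}" "is_minor (grid (gm G)) G"
proof -
  have "k \<le> card (pverts G)" if "is_minor (grid k) G" for k
  proof -
    have "k \<le> k * k" by (cases k) simp_all
    also have "k * k = card (pverts (grid k))" by (simp add: grid_def card_cartesian_product)
    also have "\<dots> \<le> card (pverts G)"
      by (rule is_minor_card_le[OF assms _ that]) (simp add: grid_def)
    finally show ?thesis .
  qed
  then have "{k. is_minor (grid k) G} \<subseteq> {..card (pverts G)}" by blast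
  then show fin: "finite {k. is_minor (grid k) G}"
    by (rule finite_subset) simp
  have "0 \<in> {k. is_minor (grid k) G}" by (simp add: is_minor_def grid_def)
  then have "Max {k. is_minor (grid k) G} \<in> {k. is_minor (grid k) G}"
    by (intro Max_in fin) blast
  then show "is_minor (grid (gm G)) G"
    unfolding gm_def by (rule CollectD)
qed

lemma tree_decomposition_single_bag:
  fixes G :: "'a pair_pre_digraph"
  assumes "pair_graph G"
  shows "tree_decomposition G \<lparr> pverts = {0 :: nat}, parcs = {} \<rparr> (\<lambda>_. pverts G)"
proof -
  interpret G: pair_graph G by fact
  define T where "T = \<lparr> pverts = {0 :: nat}, parcs = {} \<rparr>"
  have [simp]: "pverts T = {0}" "parcs T = {}" by (simp_all add: T_def)
  have T: "pair_graph T"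
    by unfold_locales (simp_all add: symmetric_def sym_def)
  have c: "Digraph_Component.connected (with_proj T \<restriction> A)" if "A = {0}" for A
    unfolding Digraph_Component.connected_def mk_symmetric_def that
    by (intro strongly_connectedI) (simp_all add: reachable_def rtrancl_on_refl)
  have r: "with_proj T \<restriction> {0} = with_proj T"
    by (simp add: induce_subgraph_def with_proj_def)
  have "\<not> pre_digraph.cycle (with_proj T) p" for p
    unfolding pre_digraph.cycle_def pre_digraph.awalk_def by simp
  with T c[OF refl] have "graph_tree T" by (simp add: graph_tree_def r)
  then have "tree_decomposition G T (\<lambda>_. pverts G)"
    using c G.in_arcsD1 G.in_arcsD2 by (auto simp: tree_decomposition_def induces_connected_def)
  then show ?thesis by (simp add: T_def)
qed

lemma treewidth_attained:
  fixes G :: "'a pair_pre_digraph"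
  assumes "pair_graph G"
  shows "\<exists>(T :: nat pair_pre_digraph) B. tree_decomposition G T B \<and>
           decomposition_width T B = treewidth G \<and>
           (\<forall>(T' :: nat pair_pre_digraph) B'. tree_decomposition G T' B' \<longrightarrow>
              decomposition_width T B \<le> decomposition_width T' B')"
proof -
  let ?P = "\<lambda>(T :: nat pair_pre_digraph, B). tree_decomposition G T B"
  let ?w = "\<lambda>(T :: nat pair_pre_digraph, B :: nat \<Rightarrow> 'a set). decomposition_width T B"
  obtain X where X: "?P X" and least: "\<And>Y. ?P Y \<Longrightarrow> nat (?w X + 1) \<le> nat (?w Y + 1)"
    using ex_has_least_nat[of ?P _ "\<lambda>Y. nat (?w Y + 1)"] tree_decomposition_single_bag[OF assms]
    by (metis (no_types, lifting) case_prod_conv)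
  obtain T B where TB: "X = (T, B)" by fastforce
  have nonneg: "decomposition_width T' B' + 1 \<ge> 0" for T' :: "nat pair_pre_digraph" and B' :: "nat \<Rightarrow> 'a set"
    by (simp add: decomposition_width_def)
  have min: "decomposition_width T B \<le> decomposition_width T' B'"
    if "tree_decomposition G T' B'" for T' :: "nat pair_pre_digraph" and B'
    using least[of "(T', B')"] that TB nonneg[of T B] nonneg[of T' B'] by (simp add: nat_le_eq_zle)
  have "treewidth G = decomposition_width T B"
    unfolding treewidth_def using X TB min by (intro cInf_eq_minimum) auto
  then show ?thesis using X TB min by auto
qed

end

theory Submission
  imports Defs
begin

text \<open>
  Let \<open>k\<close> be the side of a grid minor of \<open>S \<cdot> H\<close>, let \<open>t = tw(H) + 1\<close>, and suppose \<open>k\<^sup>2 > 4nt\<close>.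
  At most \<open>n\<close> grid vertices have a branch set meeting the copy of \<open>H\<close> at the centre of the star; call
  their set \<open>X\<close>. Every other branch set lives in a single leaf copy of \<open>H\<close>, and grid neighbours outside
  \<open>X\<close> live in the same copy. Two facts follow.

  \<^item> An \<open>m \<times> m\<close> subgrid (\<open>m \<ge> 2\<close>) has at least \<open>m + 1 - t\<close> vertices in \<open>X\<close>: the members of its
    bramble of order \<open>m + 1\<close> that avoid \<open>X\<close> touch, so they induce a bramble in one copy of \<open>H\<close>, and
    a bag of size at most \<open>t\<close> hits all of it.
  \<^item> A copy of \<open>H\<close> hosts at most \<open>n\<close> branch sets. A label class of size \<open>s\<close> meeting \<open>r\<close> rows and \<open>c\<close>
    columns has \<open>s \<le> \<surd>n (r + c) / 2\<close>, and every row or column that a class meets is left by the class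
    at a vertex of \<open>X\<close> or at the border. Hence \<open>k\<^sup>2 - |X| \<le> \<surd>n (|X| + k)\<close>, which forces \<open>t\<^sup>2 < n\<close>.

  Cut the grid into \<open>q \<times> q\<close> nearly equal windows with \<open>q\<close> the integer nearest to \<open>k / 2t\<close>. The first
  fact gives \<open>4tn \<ge> k\<^sup>2 - (k - 2tq)\<^sup>2 + 3tq\<^sup>2 \<ge> k\<^sup>2 - t\<^sup>2 + 3tq\<^sup>2\<close>, and \<open>t\<^sup>2 < n\<close> makes \<open>q\<close> large enough for
  \<open>3q\<^sup>2 \<ge> t\<close>, a contradiction.
\<close>

subsection \<open>Connected sets, Helly property and brambles\<close>

text \<open>Stated for a bare relation, so that the same facts serve the grid, \<open>H\<close>, the
  product and the decomposition tree without forming induced subgraphs.\<close>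

definition conn :: "('a \<times> 'a) set \<Rightarrow> 'a set \<Rightarrow> bool" where
  "conn E A \<longleftrightarrow> A \<noteq> {} \<and> (\<forall>x\<in>A. \<forall>y\<in>A. (x, y) \<in> (Restr E A)\<^sup>*)"

lemma connD: "conn E A \<Longrightarrow> x \<in> A \<Longrightarrow> y \<in> A \<Longrightarrow> (x, y) \<in> (Restr E A)\<^sup>*"
  by (simp add: conn_def)

lemma conn_singleton: "conn E {x}"
  by (simp add: conn_def)

lemma Restr_rtrancl_mono:
  "(x, y) \<in> (Restr E A)\<^sup>* \<Longrightarrow> A \<subseteq> B \<Longrightarrow> (x, y) \<in> (Restr E B)\<^sup>*"
  by (rule subsetD[OF rtrancl_mono]) auto

lemma conn_if_induces_connected:
  assumes "pair_graph G" "induces_connected G A"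
  shows "conn (parcs G) A"
proof -
  interpret pair_graph G by fact
  have "(x, y) \<in> (Restr (parcs G) A)\<^sup>*"
    if "(x, y) \<in> rtrancl_on A {(u, v) \<in> parcs G. u \<in> A \<and> v \<in> A}" for x y
    using that by induction (auto intro: converse_rtrancl_into_rtrancl)
  moreover have "parcs (mk_symmetric (with_proj G \<restriction> A)) = {(u, v) \<in> parcs G. u \<in> A \<and> v \<in> A}"
    by (auto simp: parcs_mk_symmetric intro: arcs_symmetric)
  ultimately show ?thesis
    using connected_nonempty[OF assms(2)] assms(2)
    unfolding conn_def induces_connected_def Digraph_Component.connected_def
      strongly_connected_def reachable_def by simp
qed

text \<open>A walk in the index set \<open>F\<close> lifts to the union: move inside one part, then
  cross to the next where the two touch. Images, unions of branch sets and unions of subtrees are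
  all instances.\<close>

lemma conn_UN:
  assumes F: "conn I F" and P: "\<And>v. v \<in> F \<Longrightarrow> conn E (P v)"
    and touch: "\<And>u v. (u, v) \<in> I \<Longrightarrow> u \<in> F \<Longrightarrow> v \<in> F \<Longrightarrow>
      \<exists>x\<in>P u. \<exists>y\<in>P v. x = y \<or> (x, y) \<in> E"
  shows "conn E (\<Union>v\<in>F. P v)"
proof -
  let ?U = "\<Union>v\<in>F. P v"
  have inside: "(x, y) \<in> (Restr E ?U)\<^sup>*" if "v \<in> F" "x \<in> P v" "y \<in> P v" for v x y
    using connD[OF P[OF that(1)] that(2,3)] by (rule Restr_rtrancl_mono) (use that in blast)
  have *: "\<forall>x\<in>P u. \<forall>y\<in>P v. (x, y) \<in> (Restr E ?U)\<^sup>*" if "(u, v) \<in> (Restr I F)\<^sup>*" "u \<in> F" for u v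
    using that
  proof induction
    case base
    then show ?case using inside by blast
  next
    case (step v w)
    then obtain a b where ab: "a \<in> P v" "b \<in> P w" "a = b \<or> (a, b) \<in> E"
      using touch by blast
    have "(a, b) \<in> (Restr E ?U)\<^sup>*" using ab step(2) by auto
    moreover have "\<forall>x\<in>P u. (x, a) \<in> (Restr E ?U)\<^sup>*"
      using step ab by blast
    moreover have "\<forall>y\<in>P w. (b, y) \<in> (Restr E ?U)\<^sup>*"
      using step ab inside by blast
    ultimately show ?case by (meson rtrancl_trans)
  qed
  have "(x, y) \<in> (Restr E ?U)\<^sup>*" if "x \<in> ?U" "y \<in> ?U" for x y
  proof -
    obtain u v where uv: "u \<in> F" "v \<in> F" "x \<in> P u" "y \<in> P v" using \<open>x \<in> ?U\<close> \<open>y \<in> ?U\<close> by blast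
    with * connD[OF F] show ?thesis by blast
  qed
  moreover have "?U \<noteq> {}"
  proof -
    obtain v where "v \<in> F" using F unfolding conn_def by blast
    moreover from this P have "P v \<noteq> {}" unfolding conn_def by blast
    ultimately show ?thesis by blast
  qed
  ultimately show ?thesis unfolding conn_def by blast
qed

lemma conn_Un:
  assumes "conn E A" "conn E B" "x \<in> A" "y \<in> B" "x = y \<or> (x, y) \<in> E \<and> (y, x) \<in> E"
  shows "conn E (A \<union> B)"
proof -
  \<comment> \<open>With \<open>I = UNIV\<close> both orders of the two indices are arcs, which is
    why the link between \<open>A\<close> and \<open>B\<close> is assumed in both
    directions.\<close>
  have "conn E (\<Union>b\<in>UNIV. if b then A else B)"
    by (rule conn_UN[where I = UNIV]) (use assms in \<open>auto simp: conn_def\<close>)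
  then show ?thesis by (simp add: UNIV_bool Un_commute)
qed

lemma conn_image_atLeastLessThan:
  fixes f :: "nat \<Rightarrow> 'a"
  assumes "a < b" "\<And>i. a \<le> i \<Longrightarrow> Suc i < b \<Longrightarrow> (f i, f (Suc i)) \<in> E \<and> (f (Suc i), f i) \<in> E"
  shows "conn E (f ` {a..<b})"
  using assms
proof (induction b)
  case (Suc b)
  show ?case
  proof (cases "a = b")
    case True
    then show ?thesis by (simp add: conn_singleton)
  next
    case False
    with Suc.prems have ab: "a < b" by simp
    then obtain c where c: "b = Suc c" "a \<le> c" by (cases b) auto
    have "conn E (f ` {a..<b} \<union> {f b})"
      by (rule conn_Un[OF Suc.IH conn_singleton, of "f c" "f b"]) (use Suc.prems ab c in auto)
    then show ?thesis using ab by (simp add: atLeastLessThanSuc)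
  qed
qed simp

lemma conn_const:
  assumes "conn E A" "\<And>x y. (x, y) \<in> E \<Longrightarrow> x \<in> A \<Longrightarrow> y \<in> A \<Longrightarrow> f x = f y"
    "x \<in> A" "y \<in> A"
  shows "f x = f y"
  using connD[OF assms(1,3,4)] by induction (use assms(2) in auto)

lemma conn_image:
  assumes "conn E A" "\<And>x y. (x, y) \<in> E \<Longrightarrow> x \<in> A \<Longrightarrow> y \<in> A \<Longrightarrow> (f x, f y) \<in> E'"
  shows "conn E' (f ` A)"
proof -
  have "conn E' (\<Union>x\<in>A. {f x})"
    by (rule conn_UN[OF assms(1) conn_singleton]) (use assms(2) in auto)
  then show ?thesis by (simp add: UNION_singleton_eq_range)
qed

text \<open>Within \<open>S\<close> a walk can enter and leave \<open>v\<close> only through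
  \<open>u\<close>, so its visits to \<open>v\<close> can be cut out.\<close>

lemma conn_remove_pendant:
  assumes S: "conn E S" "S \<noteq> {v}"
    and sym: "sym E" and irr: "(v, v) \<notin> E"
    and u: "\<And>w. w \<in> S \<Longrightarrow> (v, w) \<in> E \<Longrightarrow> w = u"
  shows "conn E (S - {v})" "v \<in> S \<Longrightarrow> u \<in> S \<and> u \<noteq> v"
proof -
  let ?R = "(Restr E (S - {v}))\<^sup>*"
  have uS: "u \<in> S \<and> u \<noteq> v" if "v \<in> S"
  proof -
    obtain w where w: "w \<in> S" "w \<noteq> v" using S unfolding conn_def by blast
    have "(v, w) \<in> (Restr E S)\<^sup>*" using connD[OF S(1) that w(1)] .
    then obtain z where "(v, z) \<in> Restr E S" using w(2) by (auto elim: converse_rtranclE)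
    then show ?thesis using u irr by auto
  qed
  then show "v \<in> S \<Longrightarrow> u \<in> S \<and> u \<noteq> v" .
  \<comment> \<open>While the walk stands at \<open>v\<close>, the invariant records
    \<open>u\<close> instead, the vertex it came from and must return to.\<close>
  have "if y = v then (x, u) \<in> ?R else (x, y) \<in> ?R"
    if "(x, y) \<in> (Restr E S)\<^sup>*" "x \<noteq> v" "x \<in> S" for x y
    using that
  proof induction
    case (step y z)
    show ?case
    proof (cases "y = v")
      case True
      then have "z = u" "v \<in> S" using u step.hyps by auto
      then show ?thesis using step True uS by auto
    next
      case False
      show ?thesis
      proof (cases "z = v")
        case True
        then have "(v, y) \<in> E" "y \<in> S" using step.hyps sym by (auto dest: symD)
        then have "y = u" using u by blast
        then show ?thesis using step True False by auto
      next
        case zv: False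
        then have "(y, z) \<in> Restr E (S - {v})" using step.hyps False by auto
        then show ?thesis using step False zv by (auto intro: rtrancl_into_rtrancl)
      qed
    qed
  qed simp
  moreover have "S - {v} \<noteq> {}" using S unfolding conn_def by blast
  ultimately show "conn E (S - {v})" 
    unfolding conn_def using connD[OF S(1)] by (metis DiffE insertI1)
qed

text \<open>
  Acyclicity of \<open>E\<close> on \<open>A\<close> enters as: every non-empty subset of \<open>A\<close> has a vertex with at most one
  neighbour in it.
\<close>

lemma helly_forest:
  assumes "finite A" "sym E" "irrefl E"
    and pendant: "\<And>A'. A' \<subseteq> A \<Longrightarrow> A' \<noteq> {} \<Longrightarrow>
      \<exists>v\<in>A'. \<exists>u. \<forall>w\<in>A'. (v, w) \<in> E \<longrightarrow> w = u"
    and "\<F> \<noteq> {}" "\<And>S. S \<in> \<F> \<Longrightarrow> S \<subseteq> A \<and> conn E S"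
    and "\<And>S S'. S \<in> \<F> \<Longrightarrow> S' \<in> \<F> \<Longrightarrow> S \<inter> S' \<noteq> {}"
  shows "\<exists>s. \<forall>S\<in>\<F>. s \<in> S"
  using assms(1,4-)
proof (induction arbitrary: \<F> rule: finite_psubset_induct)
  case (psubset A)
  have "A \<noteq> {}" using psubset.prems(2,3) unfolding conn_def by blast
  then obtain v u where v: "v \<in> A" "\<And>w. w \<in> A \<Longrightarrow> (v, w) \<in> E \<Longrightarrow> w = u"
    using psubset.prems(1)[of A] by blast
  have irr: "(v, v) \<notin> E" using assms(3) by (simp add: irrefl_def)
  show ?case
  proof (cases "{v} \<in> \<F>")
    case True
    then show ?thesis using psubset.prems(4) by blast
  next
    case False
    have S: "conn E (S - {v})" "v \<in> S \<Longrightarrow> u \<in> S \<and> u \<noteq> v" if "S \<in> \<F>" for S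
      using conn_remove_pendant[of E S v u, OF _ _ assms(2) irr] psubset.prems(3)[OF that] False that v
      by (metis subsetD)+
    \<comment> \<open>Deleting \<open>v\<close> keeps the hypotheses: the members stay connected,
      and two members that meet in \<open>v\<close> also share its neighbour
      \<open>u\<close>.\<close>
    have "\<exists>s. \<forall>S\<in>(\<lambda>S. S - {v}) ` \<F>. s \<in> S"
    proof (rule psubset.IH)
      show "A - {v} \<subset> A" using v by blast
      show "\<exists>v\<in>A'. \<exists>u. \<forall>w\<in>A'. (v, w) \<in> E \<longrightarrow> w = u" if "A' \<subseteq> A - {v}" "A' \<noteq> {}" for A'
        using psubset.prems(1) that by blast
      show "(\<lambda>S. S - {v}) ` \<F> \<noteq> {}" using psubset.prems(2) by blast
      show "S \<subseteq> A - {v} \<and> conn E S" if "S \<in> (\<lambda>S. S - {v}) ` \<F>" for S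
        using that S(1) psubset.prems(3) by blast
      show "S \<inter> S' \<noteq> {}" if SS: "S \<in> (\<lambda>S. S - {v}) ` \<F>" "S' \<in> (\<lambda>S. S - {v}) ` \<F>" for S S'
      proof -
        obtain P P' where P: "P \<in> \<F>" "P' \<in> \<F>" "S = P - {v}" "S' = P' - {v}" using SS by blast
        obtain x where "x \<in> P" "x \<in> P'" using psubset.prems(4) P by blast
        then show ?thesis using S(2) P by (cases "x = v") blast+
      qed
    qed
    then obtain s where "\<forall>S\<in>(\<lambda>S. S - {v}) ` \<F>. s \<in> S" ..
    then have "\<forall>S\<in>\<F>. s \<in> S" by simp
    then show ?thesis ..
  qed
qed

section \<open>Pendant vertices of trees, and bags that hit a bramble\<close>

text \<open>Zipping a vertex list with its tail gives the arc list on which the library's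
  \<open>cycle\<close> is defined; this and the next two lemmas translate.\<close>

lemma pcas_zip: "pcas x (zip (x # xs) (xs @ [y])) y"
  by (induction xs arbitrary: x) auto

lemma pawalk_verts_zip: "pawalk_verts x (zip (x # xs) (xs @ [y])) = x # xs @ [y]"
  by (induction xs arbitrary: x) auto

lemma set_zip_successively:
  "successively (\<lambda>x y. (x, y) \<in> E) (x # xs @ [y]) \<Longrightarrow> set (zip (x # xs) (xs @ [y])) \<subseteq> E"
proof (induction xs arbitrary: x)
  case (Cons a xs)
  then have "(x, a) \<in> E" "set (zip (a # xs) (xs @ [y])) \<subseteq> E" by simp_all
  then show ?case by (simp only: append_Cons zip_Cons_Cons list.set insert_subset simp_thms)
qed simp

lemma graph_tree_pendant:
  assumes T: "graph_tree T" and A: "A \<subseteq> pverts T" "A \<noteq> {}"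
  shows "\<exists>v\<in>A. \<exists>u. \<forall>w\<in>A. (v, w) \<in> parcs T \<longrightarrow> w = u"
proof -
  let ?E = "parcs T"
  interpret pair_graph T using T by (simp add: graph_tree_def)
  \<comment> \<open>An end of a longest path has no second neighbour, which would lie on the path and close a cycle.\<close>
  define P where "P p \<longleftrightarrow> distinct p \<and> p \<noteq> [] \<and> set p \<subseteq> A \<and> successively (\<lambda>x y. (x, y) \<in> ?E) p" for p
  have finA: "finite A" using A finite_subset pair_finite_verts by blast
  obtain a where "a \<in> A" using A by blast
  then have "P [a]" by (simp add: P_def)
  moreover have "length p \<le> card A" if "P p" for p
    using that finA card_mono unfolding P_def by (metis distinct_card)
  ultimately obtain p where p: "P p" and max: "\<And>q. P q \<Longrightarrow> length q \<le> length p"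
    using ex_has_greatest_nat[of P "[a]" length "Suc (card A)"] by (auto simp: less_Suc_eq_le)
  obtain v ps where vps: "p = v # ps" using p by (cases p) (auto simp: P_def)
  have "v \<in> A" using p vps by (simp add: P_def)
  \<comment> \<open>For empty \<open>ps\<close> the value \<open>hd ps\<close> is arbitrary, but
    then \<open>v\<close> has no neighbour in \<open>A\<close>, since one would extend the
    path.\<close>
  moreover have "w = hd ps" if w: "w \<in> A" "(v, w) \<in> ?E" for w
  proof (rule ccontr)
    assume neq: "w \<noteq> hd ps"
    have wv: "(w, v) \<in> ?E" using w arcs_symmetric by blast
    have "w \<noteq> v" using no_loops' w by blast
    have "w \<in> set p"
    proof (rule ccontr)
      assume "w \<notin> set p"
      then have "P (w # p)" using p w wv vps by (auto simp: P_def)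
      then show False using max by fastforce
    qed
    then have "w \<in> set ps" using \<open>w \<noteq> v\<close> vps by simp
    then obtain ys zs where ps: "ps = ys @ w # zs" by (meson split_list)
    \<comment> \<open>A vertex \<open>y\<close> strictly between \<open>v\<close> and
      \<open>w\<close> on the path gives the closed walk length at least 3, as required to
      contradict \<open>graph_tree\<close>.\<close>
    with neq obtain y ys' where ys: "ys = y # ys'" by (cases ys) auto
    have "successively (\<lambda>x y. (x, y) \<in> ?E) ((v # ys @ [w]) @ zs)"
      using p unfolding P_def vps ps by simp
    then have "successively (\<lambda>x y. (x, y) \<in> ?E) (v # ys @ [w])"
      by (simp only: successively_append_iff)
    then have succ: "successively (\<lambda>x y. (x, y) \<in> ?E) (v # (ys @ [w]) @ [v])"
      using wv successively_append_iff[of _ "v # ys @ [w]" "[v]"] by simp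
    define c where "c = zip (v # ys @ [w]) ((ys @ [w]) @ [v])"
    have "set c \<subseteq> ?E" unfolding c_def using set_zip_successively[OF succ] by simp
    moreover have "pcas v c v" unfolding c_def using pcas_zip[of v "ys @ [w]" v] by simp
    ultimately have "awalk v c v" unfolding awalk_def using \<open>v \<in> A\<close> A by blast
    moreover have "pawalk_verts v c = v # (ys @ [w]) @ [v]"
      unfolding c_def using pawalk_verts_zip[of v "ys @ [w]" v] by simp
    moreover have "distinct ((ys @ [w]) @ [v])" using p unfolding P_def vps ps by auto
    moreover have "length c \<ge> 3" unfolding c_def ys by simp
    moreover from this have "c \<noteq> []" by auto
    ultimately have "cycle c" "length c \<ge> 3" unfolding cycle_def by auto
    then show False using T unfolding graph_tree_def by blast
  qed
  ultimately show ?thesis by blast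
qed

text \<open>The easy half of treewidth duality. The nodes whose bags meet \<open>U\<close> form a
  subtree \<open>S U\<close>; members that touch have intersecting subtrees, because the ends of an
  edge share a bag. The Helly property yields a common node.\<close>

lemma bramble_bag:
  assumes G: "pair_graph G" and D: "tree_decomposition G T B"
    and ne: "\<U> \<noteq> {}"
    and U: "\<And>U. U \<in> \<U> \<Longrightarrow> U \<subseteq> pverts G \<and> conn (parcs G) U"
    and touch: "\<And>U U'. U \<in> \<U> \<Longrightarrow> U' \<in> \<U> \<Longrightarrow> \<exists>x\<in>U. \<exists>y\<in>U'. x = y \<or> (x, y) \<in> parcs G"
  shows "\<exists>s\<in>pverts T. \<forall>U\<in>\<U>. U \<inter> B s \<noteq> {}"
proof -
  have tree: "graph_tree T" using D by (simp add: tree_decomposition_def)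
  interpret T: pair_graph T using tree by (simp add: graph_tree_def)
  define N where "N v = {s \<in> pverts T. v \<in> B s}" for v
  define S where "S U = (\<Union>v\<in>U. N v)" for U
  have N: "conn (parcs T) (N v)" if "v \<in> pverts G" for v
    using conn_if_induces_connected[of T "N v"] T.pair_graph that D
    unfolding N_def tree_decomposition_def by blast
  have edge: "N u \<inter> N v \<noteq> {}" if "(u, v) \<in> parcs G" for u v
    using D that unfolding N_def tree_decomposition_def by blast
  have N_touch: "N u \<inter> N v \<noteq> {}" if "u = v \<or> (u, v) \<in> parcs G" "u \<in> pverts G" for u v
    using that edge N unfolding conn_def by blast
  have "\<exists>s. \<forall>Q\<in>S ` \<U>. s \<in> Q"
  proof (rule helly_forest[of "pverts T" "parcs T"])
    show "sym (parcs T)" by (rule symI) (rule T.arcs_symmetric)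
    show "irrefl (parcs T)" using T.no_loops' by (auto simp: irrefl_def)
    show "S ` \<U> \<noteq> {}" using ne by blast
    show "Q \<subseteq> pverts T \<and> conn (parcs T) Q" if Q: "Q \<in> S ` \<U>" for Q
    proof -
      obtain V where V: "V \<in> \<U>" "Q = S V" using Q by blast
      have "conn (parcs T) (S V)" unfolding S_def
      proof (rule conn_UN)
        show "conn (parcs G) V" using U V by blast
      qed (use U V N N_touch in blast)+
      then show ?thesis using V by (auto simp: S_def N_def)
    qed
    show "Q \<inter> Q' \<noteq> {}" if Q: "Q \<in> S ` \<U>" "Q' \<in> S ` \<U>" for Q Q'
    proof -
      obtain V V' where V: "V \<in> \<U>" "V' \<in> \<U>" "Q = S V" "Q' = S V'" using Q by blast
      obtain x y where "x \<in> V" "y \<in> V'" "x = y \<or> (x, y) \<in> parcs G" using touch V by blast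
      moreover have "x \<in> pverts G" using U V calculation by blast
      ultimately show ?thesis using N_touch[of x y] unfolding V S_def by blast
    qed
  qed (use graph_tree_pendant[OF tree] in auto)
  then obtain s where s: "\<And>U. U \<in> \<U> \<Longrightarrow> s \<in> S U" by blast
  have "s \<in> pverts T" using ne s unfolding S_def N_def by blast
  moreover have "U \<inter> B s \<noteq> {}" if "U \<in> \<U>" for U using s[OF that] unfolding S_def N_def by blast
  ultimately show ?thesis by blast
qed


subsection \<open>Grids\<close>

text \<open>
  The crosses of the \<open>(m - 1) \<times> (m - 1)\<close> square at \<open>(a, b)\<close>, the row \<open>a + m - 1\<close> below it, and the
  column \<open>b + m - 1\<close> beside it without the corner. For \<open>m = 1\<close> the last set is empty.
\<close>

definition square_bramble :: "nat \<Rightarrow> nat \<Rightarrow> nat \<Rightarrow> (nat \<times> nat) set set" where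
  "square_bramble a b m =
     {Pair i ` {b..<b + m - 1} \<union> (\<lambda>i. (i, j)) ` {a..<a + m - 1} | i j.
        i \<in> {a..<a + m - 1} \<and> j \<in> {b..<b + m - 1}} \<union>
     {Pair (a + m - 1) ` {b..<b + m}, (\<lambda>i. (i, b + m - 1)) ` {a..<a + m - 1}}"

lemma parcs_grid_iff:
  "((i, j), (i', j')) \<in> parcs (grid k) \<longleftrightarrow> i < k \<and> j < k \<and> i' < k \<and> j' < k \<and>
     (i = i' \<and> (j' = Suc j \<or> j = Suc j') \<or> j = j' \<and> (i' = Suc i \<or> i = Suc i'))"
  by (simp add: grid_def)

lemma square_bramble_subset:
  assumes "2 \<le> m" "F \<in> square_bramble a b m"
  shows "F \<subseteq> {a..<a + m} \<times> {b..<b + m}"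
  using assms unfolding square_bramble_def by fastforce

lemma conn_square_bramble:
  assumes m: "2 \<le> m" and k: "a + m \<le> k" "b + m \<le> k" and F: "F \<in> square_bramble a b m"
  shows "conn (parcs (grid k)) F"
proof -
  have row: "conn (parcs (grid k)) (Pair i ` {b..<c})" if "i < k" "b < c" "c \<le> k" for i c
    by (rule conn_image_atLeastLessThan) (use that in \<open>auto simp: parcs_grid_iff\<close>)
  have col: "conn (parcs (grid k)) ((\<lambda>i. (i, j)) ` {a..<a + m - 1})" if "j < k" for j
    by (rule conn_image_atLeastLessThan) (use that m k in \<open>auto simp: parcs_grid_iff\<close>)
  consider i j where "i \<in> {a..<a + m - 1}" "j \<in> {b..<b + m - 1}"
      "F = Pair i ` {b..<b + m - 1} \<union> (\<lambda>i. (i, j)) ` {a..<a + m - 1}"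
    | "F = Pair (a + m - 1) ` {b..<b + m}"
    | "F = (\<lambda>i. (i, b + m - 1)) ` {a..<a + m - 1}"
    using F unfolding square_bramble_def by blast
  then show ?thesis
  proof cases
    case (1 i j)
    show ?thesis unfolding 1(3)
    proof (rule conn_Un[OF row col])
      show "(i, j) \<in> Pair i ` {b..<b + m - 1}" "(i, j) \<in> (\<lambda>i. (i, j)) ` {a..<a + m - 1}"
        using 1 by auto
    qed (use 1 m k in auto)
  next
    case 2
    show ?thesis unfolding 2 by (rule row) (use m k in auto)
  next
    case 3
    show ?thesis unfolding 3 by (rule col) (use m k in auto)
  qed
qed

text \<open>The crosses at \<open>(i, j)\<close> and \<open>(i', j')\<close> share
  \<open>(i, j')\<close>. A cross reaches the bottom row \<open>R\<close> at the foot of its column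
  and the last column \<open>C\<close> at the end of its row; \<open>R\<close> and \<open>C\<close>
  touch at the corner.\<close>

lemma square_bramble_touch:
  assumes m: "2 \<le> m" and k: "a + m \<le> k" "b + m \<le> k"
    and F: "F \<in> square_bramble a b m" and F': "F' \<in> square_bramble a b m"
  shows "\<exists>x\<in>F. \<exists>y\<in>F'. x = y \<or> (x, y) \<in> parcs (grid k)"
proof -
  define cross where
    "cross i j = Pair i ` {b..<b + m - 1} \<union> (\<lambda>i. (i, j)) ` {a..<a + m - 1}" for i j
  define R where "R = Pair (a + m - 1) ` {b..<b + m}"
  define C where "C = (\<lambda>i. (i, b + m - 1)) ` {a..<a + m - 1}"
  obtain l where l: "m = Suc (Suc l)" using m by (metis add_2_eq_Suc le_Suc_ex)
  have RC: "(a + m - 1, b + m - 1) \<in> R" "(a + m - 2, b + m - 1) \<in> C"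
    "((a + m - 1, b + m - 1), (a + m - 2, b + m - 1)) \<in> parcs (grid k)"
    "((a + m - 2, b + m - 1), (a + m - 1, b + m - 1)) \<in> parcs (grid k)"
    using k by (auto simp: R_def C_def l parcs_grid_iff)
  have cross: "(i, j') \<in> cross i j" "(i', j) \<in> cross i j"
    if "i' \<in> {a..<a + m - 1}" "j' \<in> {b..<b + m - 1}" for i j i' j'
    using that by (auto simp: cross_def)
  have cR: "(a + m - 2, j) \<in> cross i j" "(a + m - 1, j) \<in> R"
    "((a + m - 2, j), (a + m - 1, j)) \<in> parcs (grid k)"
    "((a + m - 1, j), (a + m - 2, j)) \<in> parcs (grid k)"
    if "i \<in> {a..<a + m - 1}" "j \<in> {b..<b + m - 1}" for i j
    using k that by (auto simp: cross_def R_def l parcs_grid_iff)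
  have cC: "(i, b + m - 2) \<in> cross i j" "(i, b + m - 1) \<in> C"
    "((i, b + m - 2), (i, b + m - 1)) \<in> parcs (grid k)"
    "((i, b + m - 1), (i, b + m - 2)) \<in> parcs (grid k)"
    if "i \<in> {a..<a + m - 1}" "j \<in> {b..<b + m - 1}" for i j
    using k that by (auto simp: cross_def C_def l parcs_grid_iff)
  have cases: "(\<exists>i\<in>{a..<a + m - 1}. \<exists>j\<in>{b..<b + m - 1}. F = cross i j) \<or> F = R \<or> F = C"
    if "F \<in> square_bramble a b m" for F
    using that unfolding square_bramble_def cross_def R_def C_def by blast
  define touch where "touch A B \<longleftrightarrow> (\<exists>x\<in>A. \<exists>y\<in>B. x = y \<or> (x, y) \<in> parcs (grid k))" for A B
  have touchI: "touch A B" if "x \<in> A" "y \<in> B" "x = y \<or> (x, y) \<in> parcs (grid k)" for A B x y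
    using that unfolding touch_def by blast
  have "touch (cross i j) (cross i' j')"
    if "i \<in> {a..<a + m - 1}" "j \<in> {b..<b + m - 1}" "i' \<in> {a..<a + m - 1}" "j' \<in> {b..<b + m - 1}"
    for i j i' j'
    by (rule touchI[of "(i, j')" _ "(i, j')"])
      (use cross(1)[where i = i and j = j] cross(2)[where i = i' and j = j'] that in blast)+
  moreover have "touch (cross i j) R" "touch R (cross i j)" "touch (cross i j) C" "touch C (cross i j)"
    if ij: "i \<in> {a..<a + m - 1}" "j \<in> {b..<b + m - 1}" for i j
    using touchI[OF cR(1,2)[OF ij]] touchI[OF cR(2,1)[OF ij]] touchI[OF cC(1,2)[OF ij]]
      touchI[OF cC(2,1)[OF ij]] cR(3,4)[OF ij] cC(3,4)[OF ij] by blast+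
  moreover have "touch R R" "touch C C" "touch R C" "touch C R"
    using touchI[OF RC(1) RC(1)] touchI[OF RC(2) RC(2)] touchI[OF RC(1,2)] touchI[OF RC(2,1)] RC(3,4)
    by blast+
  ultimately have "touch F F'" using cases[OF F] cases[OF F'] by metis
  then show ?thesis by (simp add: touch_def)
qed

text \<open>If \<open>Y\<close> missed both a row and a column of the small square, it would miss
  their cross. So it has \<open>m - 1\<close> points there, and one more in each of the bottom row
  and the last column, which are disjoint from the square and from each other.\<close>

lemma square_bramble_order:
  assumes m: "2 \<le> m" and Y: "finite Y" and hit: "\<And>F. F \<in> square_bramble a b m \<Longrightarrow> F \<inter> Y \<noteq> {}"
  shows "m + 1 \<le> card Y"
proof -
  let ?I = "{a..<a + m - 1}" and ?J = "{b..<b + m - 1}"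
  define Y0 where "Y0 = Y \<inter> ?I \<times> ?J"
  have fin: "finite Y0" using Y by (simp add: Y0_def)
  have "?I \<subseteq> fst ` Y0 \<or> ?J \<subseteq> snd ` Y0"
  proof (rule ccontr)
    assume "\<not> ?thesis"
    then obtain i j where ij: "i \<in> ?I" "i \<notin> fst ` Y0" "j \<in> ?J" "j \<notin> snd ` Y0" by blast
    then have "Pair i ` ?J \<union> (\<lambda>i. (i, j)) ` ?I \<in> square_bramble a b m"
      unfolding square_bramble_def by blast
    from hit[OF this] show False using ij unfolding Y0_def by force
  qed
  then have Y0: "m - 1 \<le> card Y0"
    using surj_card_le[OF fin, of ?I fst] surj_card_le[OF fin, of ?J snd] by auto
  obtain x where x: "x \<in> Pair (a + m - 1) ` {b..<b + m}" "x \<in> Y"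
    using hit[of "Pair (a + m - 1) ` {b..<b + m}"] unfolding square_bramble_def by blast
  obtain y where y: "y \<in> (\<lambda>i. (i, b + m - 1)) ` ?I" "y \<in> Y"
    using hit[of "(\<lambda>i. (i, b + m - 1)) ` ?I"] unfolding square_bramble_def by blast
  have "x \<notin> Y0" "y \<notin> Y0" "x \<noteq> y" using x y by (auto simp: Y0_def)
  then have "card (insert x (insert y Y0)) = card Y0 + 2" using fin by simp
  moreover have "card (insert x (insert y Y0)) \<le> card Y"
    by (rule card_mono[OF Y]) (use x y in \<open>auto simp: Y0_def\<close>)
  ultimately show ?thesis using Y0 m by linarith
qed

section \<open>Counting the rows and columns met by label classes\<close>

lemma card_row_labels_le:
  fixes L :: "nat \<times> nat \<Rightarrow> 'l"
  assumes X: "finite X"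
    and step: "\<And>i j. i < k \<Longrightarrow> Suc j < k \<Longrightarrow> (i, j) \<notin> X \<Longrightarrow> (i, Suc j) \<notin> X \<Longrightarrow>
      L (i, j) = L (i, Suc j)"
  shows "card ((\<lambda>v. (L v, fst v)) ` ({..<k} \<times> {..<k} - X)) \<le> card X + k"
proof -
  let ?V = "{..<k} \<times> {..<k} - X"
  define J where "J l i = {j. (i, j) \<in> ?V \<and> L (i, j) = l}" for l i
  \<comment> \<open>A label leaves its row at an element of \<open>X\<close> or at the border, and that position determines it.\<close>
  define g where "g = (\<lambda>(l, i). (i, Suc (Max (J l i))))"
  have Max: "Max (J l i) \<in> J l i" if "(l, i) \<in> (\<lambda>v. (L v, fst v)) ` ?V" for l i
  proof (rule Max_in)
    show "finite (J l i)" by (rule finite_subset[of _ "{..<k}"]) (auto simp: J_def)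
    show "J l i \<noteq> {}" using that by (auto simp: J_def)
  qed
  \<comment> \<open>Exits at the border are recorded in a fictitious column \<open>k\<close>, one
    per row; hence the summand \<open>k\<close>.\<close>
  have "card ((\<lambda>v. (L v, fst v)) ` ?V) \<le> card (X \<union> {..<k} \<times> {k})"
  proof (rule card_inj_on_le)
    show "inj_on g ((\<lambda>v. (L v, fst v)) ` ?V)"
    proof (rule inj_onI)
      fix p p'
      assume p: "p \<in> (\<lambda>v. (L v, fst v)) ` ?V" "p' \<in> (\<lambda>v. (L v, fst v)) ` ?V" and eq: "g p = g p'"
      obtain l i l' i' where pp: "p = (l, i)" "p' = (l', i')" by fastforce
      have "i = i'" "Max (J l i) = Max (J l' i')" using eq by (auto simp: pp g_def)
      with Max[of l i] Max[of l' i'] p have "l = l'" unfolding pp J_def by auto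
      with \<open>i = i'\<close> show "p = p'" by (simp add: pp)
    qed
    show "g ` (\<lambda>v. (L v, fst v)) ` ?V \<subseteq> X \<union> {..<k} \<times> {k}"
    proof
      fix z assume "z \<in> g ` (\<lambda>v. (L v, fst v)) ` ?V"
      then obtain l i where li: "(l, i) \<in> (\<lambda>v. (L v, fst v)) ` ?V" "z = (i, Suc (Max (J l i)))"
        by (auto simp: g_def)
      define j where "j = Max (J l i)"
      have j: "i < k" "j < k" "(i, j) \<notin> X" "L (i, j) = l"
        using Max[OF li(1)] by (auto simp: j_def J_def)
      have "finite (J l i)" by (rule finite_subset[of _ "{..<k}"]) (auto simp: J_def)
      then have "Suc j \<notin> J l i"
        using Max_ge[of "J l i" "Suc j"] unfolding j_def by linarith
      then have "Suc j = k \<or> (i, Suc j) \<in> X"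
        using step[of i j] j by (force simp: J_def)
      then show "z \<in> X \<union> {..<k} \<times> {k}" using li(2) j by (auto simp: j_def)
    qed
    show "finite (X \<union> {..<k} \<times> {k})" using X by simp
  qed
  also have "\<dots> \<le> card X + k"
    using card_Un_le[of X "{..<k} \<times> {k}"] by (simp add: card_cartesian_product)
  finally show ?thesis .
qed

lemma card_column_labels_le:
  fixes L :: "nat \<times> nat \<Rightarrow> 'l"
  assumes X: "finite X"
    and step: "\<And>i j. Suc i < k \<Longrightarrow> j < k \<Longrightarrow> (i, j) \<notin> X \<Longrightarrow> (Suc i, j) \<notin> X \<Longrightarrow>
      L (i, j) = L (Suc i, j)"
  shows "card ((\<lambda>v. (L v, snd v)) ` ({..<k} \<times> {..<k} - X)) \<le> card X + k"
proof -
  have "card ((\<lambda>v. ((L \<circ> prod.swap) v, fst v)) ` ({..<k} \<times> {..<k} - prod.swap ` X))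
      \<le> card (prod.swap ` X) + k"
    by (rule card_row_labels_le) (use X step in force)+
  moreover have "card (prod.swap ` X) = card X" by (rule card_image) simp
  moreover have "(\<lambda>v. ((L \<circ> prod.swap) v, fst v)) ` ({..<k} \<times> {..<k} - prod.swap ` X) =
    (\<lambda>v. (L v, snd v)) ` ({..<k} \<times> {..<k} - X)"
    by (force simp: image_iff)
  ultimately show ?thesis by simp
qed

text \<open>A class of size s meeting r rows and c columns has s \<le> n and s \<le> rc, so s^2
  \<le> n rc \<le> n ((r + c) / 2)^2. Take roots and sum over the labels.\<close>

lemma square_sub_card_le:
  fixes L :: "nat \<times> nat \<Rightarrow> 'l"
  assumes X: "finite X" "X \<subseteq> {..<k} \<times> {..<k}"
    and edge: "\<And>u v. (u, v) \<in> parcs (grid k) \<Longrightarrow> u \<notin> X \<Longrightarrow> v \<notin> X \<Longrightarrow> L u = L v"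
    and small: "\<And>l. card {v \<in> {..<k} \<times> {..<k} - X. L v = l} \<le> n"
  shows "real k ^ 2 - real (card X) \<le> sqrt (real n) * (real (card X) + real k)"
proof -
  let ?V = "{..<k} \<times> {..<k} - X"
  define K where "K l = {v \<in> ?V. L v = l}" for l
  have fin: "finite ?V" "\<And>l. finite (K l)" by (simp_all add: K_def)
  have one: "real (card (K l)) \<le> sqrt n / 2 * (real (card (fst ` K l)) + real (card (snd ` K l)))" for l
  proof -
    let ?r = "real (card (fst ` K l))" and ?c = "real (card (snd ` K l))" and ?x = "real (card (K l))"
    have "card (K l) \<le> card (fst ` K l \<times> snd ` K l)"
      by (rule card_mono) (use fin in \<open>auto intro: rev_image_eqI\<close>)
    then have "?x \<le> ?r * ?c" by (metis card_cartesian_product of_nat_le_iff of_nat_mult)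
    then have "?x * ?x \<le> real n * (?r * ?c)" using small[of l] by (intro mult_mono) (auto simp: K_def)
    also have "\<dots> \<le> real n * ((?r + ?c) / 2)\<^sup>2"
      using sum_squares_ge_zero[of "?r - ?c" 0] by (intro mult_left_mono) (auto simp: power2_eq_square field_simps)
    finally have "?x\<^sup>2 \<le> (sqrt n / 2 * (?r + ?c))\<^sup>2"
      by (simp add: power2_eq_square[of ?x] power_mult_distrib power_divide)
    then show ?thesis by (rule power2_le_imp_le) simp
  qed
  \<comment> \<open>With \<open>f\<close> being \<open>fst\<close> or \<open>snd\<close>, both sides
    count the pairs of a label and a row or column that it meets.\<close>
  have sum: "(\<Sum>l\<in>L ` ?V. card (f ` K l)) = card ((\<lambda>v. (L v, f v)) ` ?V)" for f :: "nat \<times> nat \<Rightarrow> 'c"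
  proof -
    have "(\<lambda>v. (L v, f v)) ` ?V = (SIGMA l:L ` ?V. f ` K l)"
      by (auto simp: K_def intro: rev_image_eqI)
    then show ?thesis using fin by simp
  qed
  have "real k ^ 2 - real (card X) = real (card ?V)"
  proof -
    have "card X \<le> k * k" using card_mono[OF _ X(2)] by (simp add: card_cartesian_product)
    then show ?thesis
      using X by (simp add: card_Diff_subset card_cartesian_product of_nat_diff power2_eq_square)
  qed
  also have "card ?V = (\<Sum>l\<in>L ` ?V. card (K l))"
    using sum.image_gen[OF fin(1), of "\<lambda>_. 1" L] unfolding K_def card_eq_sum .
  also have "real \<dots> \<le> (\<Sum>l\<in>L ` ?V. sqrt n / 2 * (real (card (fst ` K l)) + real (card (snd ` K l))))"
    using one by (simp add: sum_mono)
  also have "\<dots> = sqrt n / 2 * (real (card ((\<lambda>v. (L v, fst v)) ` ?V)) + real (card ((\<lambda>v. (L v, snd v)) ` ?V)))"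
    by (simp only: sum[symmetric] of_nat_sum sum.distrib sum_distrib_left[symmetric])
  also have "\<dots> \<le> sqrt n / 2 * ((card X + k) + (card X + k))"
    using card_row_labels_le[OF X(1), of k L] card_column_labels_le[OF X(1), of k L] edge
    by (intro mult_left_mono add_mono) (simp_all add: parcs_grid_iff flip: of_nat_add)
  finally show ?thesis by (simp add: field_simps)
qed

section \<open>Tiling the grid with square windows\<close>

text \<open>Among the \<open>q * q\<close> disjoint windows, the \<open>r * r\<close> ones where two
  wide strips cross have side \<open>m + 1\<close>, the others \<open>m\<close>. The extra unit per
  large window sums to r^2. The bound is over the integers because \<open>m + 1 - t\<close> may be
  negative.\<close>

lemma balanced_tiling_bound:
  fixes X :: "(nat \<times> nat) set"
  assumes X: "finite X" and k: "k = q * m + r" and r: "r < q" and m: "2 \<le> m"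
    and sq: "\<And>m a b. 2 \<le> m \<Longrightarrow> a + m \<le> k \<Longrightarrow> b + m \<le> k \<Longrightarrow>
      m + 1 \<le> card (X \<inter> {a..<a + m} \<times> {b..<b + m}) + t"
  shows "(int q)\<^sup>2 * (int m + 1 - int t) + (int r)\<^sup>2 \<le> int (card X)"
proof -
  define p where "p i = i * m + min i r" for i
  define s where "s i j = m + of_bool (i < r \<and> j < r)" for i j
  \<comment> \<open>The first \<open>r\<close> strips have width \<open>m + 1\<close>, the others \<open>m\<close>; each cell contributes its largest square.\<close>
  define W where "W = (\<lambda>(i, j). {p i..<p i + s i j} \<times> {p j..<p j + s i j})"
  let ?Q = "{..<q} \<times> {..<q}"
  have p_Suc: "p (Suc i) = p i + m + of_bool (i < r)" for i by (auto simp: p_def)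
  have p_mono: "p i \<le> p j" if "i \<le> j" for i j
    using lift_Suc_mono_le[of p, OF _ that] by (simp add: p_Suc)
  have s: "p i + s i j \<le> p (Suc i)" "p j + s i j \<le> p (Suc j)" for i j
    by (auto simp: p_Suc s_def)
  have pq: "p i \<le> k" if "i \<le> q" for i
    using p_mono[OF that] r by (simp add: p_def k)
  have strip: "i = i'" if "x \<in> {p i..<p (Suc i)}" "x \<in> {p i'..<p (Suc i')}" for x i i'
    using that p_mono[of "Suc i" i'] p_mono[of "Suc i'" i] by (cases i i' rule: linorder_cases) auto
  have W_sub: "W (i, j) \<subseteq> {p i..<p (Suc i)} \<times> {p j..<p (Suc j)}" for i j
    unfolding W_def prod.case
    by (intro Sigma_mono ivl_subset[THEN iffD2] disjI2 conjI order_refl s)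
  have disj: "W u \<inter> W v = {}" if "u \<noteq> v" for u v
  proof (rule ccontr)
    assume "W u \<inter> W v \<noteq> {}"
    then obtain x y where "(x, y) \<in> W u" "(x, y) \<in> W v" by auto
    moreover obtain i j i' j' where uv: "u = (i, j)" "v = (i', j')" by fastforce
    ultimately have "(x, y) \<in> {p i..<p (Suc i)} \<times> {p j..<p (Suc j)}"
      "(x, y) \<in> {p i'..<p (Suc i')} \<times> {p j'..<p (Suc j')}"
      using W_sub by blast+
    then have "i = i'" "j = j'" using strip[of x i i'] strip[of y j j'] by blast+
    then show False using \<open>u \<noteq> v\<close> uv by simp
  qed
  have cell: "int (s i j) + 1 - int t \<le> int (card (X \<inter> W (i, j)))" if "i < q" "j < q" for i j
  proof -
    have "p i + s i j \<le> k" "p j + s i j \<le> k" using s(1)[of i j] s(2)[of j i] pq[of "Suc i"] pq[of "Suc j"] that by auto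
    moreover have "2 \<le> s i j" using m by (simp add: s_def)
    ultimately have "s i j + 1 \<le> card (X \<inter> W (i, j)) + t"
      unfolding W_def prod.case by (intro sq)
    then show ?thesis by linarith
  qed
  have sum_sum: "(\<Sum>i<q. \<Sum>j<q. c + f i * f j) = (int q)\<^sup>2 * c + (\<Sum>i<q. f i) * (\<Sum>j<q. f j)"
    for c :: int and f
    by (simp add: sum.distrib sum_product power2_eq_square)
  have "(\<Sum>(i, j)\<in>?Q. int (s i j) + 1 - int t)
      = (\<Sum>(i, j)\<in>?Q. (int m + 1 - int t) + of_bool (i < r) * of_bool (j < r))"
    by (rule sum.cong) (auto simp: s_def)
  also have "\<dots> = (\<Sum>i<q. \<Sum>j<q. (int m + 1 - int t) + of_bool (i < r) * of_bool (j < r))"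
    by (simp add: sum.cartesian_product)
  also have "\<dots> = (int q)\<^sup>2 * (int m + 1 - int t) + (\<Sum>i<q. of_bool (i < r)) * (\<Sum>j<q. of_bool (j < r))"
    by (rule sum_sum)
  also have "(\<Sum>i<q. of_bool (i < r)) = int r"
  proof -
    have "{..<q} \<inter> {i. i < r} = {..<r}" using r by auto
    then show ?thesis by (simp add: sum_of_bool_eq)
  qed
  finally have "(int q)\<^sup>2 * (int m + 1 - int t) + (int r)\<^sup>2 = (\<Sum>(i, j)\<in>?Q. int (s i j) + 1 - int t)"
    by (simp add: power2_eq_square)
  also have "\<dots> \<le> (\<Sum>v\<in>?Q. int (card (X \<inter> W v)))"
    using cell by (intro sum_mono) auto
  also have "\<dots> = int (card (\<Union>v\<in>?Q. X \<inter> W v))"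
  proof -
    have "\<forall>u\<in>?Q. \<forall>v\<in>?Q. u \<noteq> v \<longrightarrow> (X \<inter> W u) \<inter> (X \<inter> W v) = {}" using disj by blast
    then show ?thesis using X by (subst card_UN_disjoint) simp_all
  qed
  also have "\<dots> \<le> int (card X)"
    using X by (intro of_nat_mono card_mono) auto
  finally show ?thesis .
qed


subsection \<open>Grid models in disjoint copies of a graph\<close>

lemma card_le_if_disjoint_hitting:
  assumes "finite A" "\<And>v. v \<in> V \<Longrightarrow> M v \<inter> A \<noteq> {}"
    and "\<And>u v. u \<in> V \<Longrightarrow> v \<in> V \<Longrightarrow> u \<noteq> v \<Longrightarrow> M u \<inter> M v = {}"
  shows "card V \<le> card A"
proof (rule card_inj_on_le)
  define f where "f v = (SOME x. x \<in> M v \<inter> A)" for v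
  have f: "f v \<in> M v \<inter> A" if "v \<in> V" for v
    unfolding f_def using assms(2)[OF that] by (metis some_in_eq)
  then show "f ` V \<subseteq> A" by blast
  show "inj_on f V"
    using f assms(3) by (intro inj_onI) (metis IntD1 disjoint_iff)
qed (fact assms(1))

text \<open>
  \<open>L v\<close> is the copy of \<open>H\<close> that hosts the branch set of \<open>v\<close> (disregarded for \<open>v \<in> X\<close>), and \<open>P v\<close> is its
  projection to \<open>H\<close>; projections from different copies may overlap.
\<close>

locale labelled_grid_model = pair_graph H for H :: "'b pair_pre_digraph" +
  fixes k :: nat and X :: "(nat \<times> nat) set" and L :: "nat \<times> nat \<Rightarrow> 'l"
    and P :: "nat \<times> nat \<Rightarrow> 'b set"
  assumes X_subset: "X \<subseteq> pverts (grid k)"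
    and branch: "v \<in> pverts (grid k) - X \<Longrightarrow> P v \<subseteq> pverts H \<and> conn (parcs H) (P v)"
    and edge: "(u, v) \<in> parcs (grid k) \<Longrightarrow> u \<notin> X \<Longrightarrow> v \<notin> X \<Longrightarrow>
      L u = L v \<and> (\<exists>x\<in>P u. \<exists>y\<in>P v. (x, y) \<in> parcs H)"
    and disjoint: "u \<in> pverts (grid k) - X \<Longrightarrow> v \<in> pverts (grid k) - X \<Longrightarrow> u \<noteq> v \<Longrightarrow>
      L u = L v \<Longrightarrow> P u \<inter> P v = {}"
begin

lemma finite_X: "finite X"
  by (rule finite_subset[OF X_subset]) (simp add: grid_def)

lemma card_hit_le:
  assumes "finite A" "Y \<subseteq> pverts (grid k) - X" "\<And>v. v \<in> Y \<Longrightarrow> L v = l \<and> P v \<inter> A \<noteq> {}"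
  shows "card Y \<le> card A"
  by (rule card_le_if_disjoint_hitting[of _ _ P])
    (use assms disjoint in \<open>metis subsetD\<close>)+

text \<open>The vertices of \<open>X\<close> in the window, together with the at most
  \<open>t\<close> vertices whose projections meet a suitable bag, hit the whole bramble of the
  window.\<close>

lemma card_square_inter_ge:
  assumes D: "tree_decomposition H T B" and t: "\<And>s. s \<in> pverts T \<Longrightarrow> card (B s) \<le> t"
    and m: "2 \<le> m" and k: "a + m \<le> k" "b + m \<le> k"
  shows "m + 1 \<le> card (X \<inter> {a..<a + m} \<times> {b..<b + m}) + t"
proof (rule ccontr)
  let ?W = "{a..<a + m} \<times> {b..<b + m}"
  assume small: "\<not> ?thesis"
  define \<B> where "\<B> = {F \<in> square_bramble a b m. F \<inter> X = {}}"
  have F: "F \<subseteq> ?W" "conn (parcs (grid k)) F" "F \<inter> X = {}" if "F \<in> \<B>" for F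
    using that square_bramble_subset[OF m] conn_square_bramble[OF m k] by (auto simp: \<B>_def)
  have W: "?W \<subseteq> pverts (grid k)" using k by (auto simp: grid_def)
  \<comment> \<open>Too few points of \<open>X\<close> lie in the window to hit every member. The
    member \<open>F0\<close> they miss fixes the common label \<open>l\<close>.\<close>
  obtain F0 where F0: "F0 \<in> \<B>"
  proof -
    have "\<exists>F\<in>square_bramble a b m. F \<inter> (X \<inter> ?W) = {}"
      using square_bramble_order[OF m, of "X \<inter> ?W" a b] finite_X small
      by (meson add_leD1 finite_Int le_trans le_add1)
    then show thesis using that square_bramble_subset[OF m, of _ a b] unfolding \<B>_def by blast
  qed
  obtain v0 where v0: "v0 \<in> F0" using F(2)[OF F0] unfolding conn_def by blast
  define l where "l = L v0"
  have inside: "L x = L y" if "F \<in> \<B>" "x \<in> F" "y \<in> F" for F x y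
    by (rule conn_const[OF F(2)[OF that(1)] _ that(2,3)]) (use edge F(3)[OF that(1)] in blast)
  have touch: "\<exists>x\<in>F. \<exists>y\<in>F'. x = y \<or> (x, y) \<in> parcs (grid k)" if "F \<in> \<B>" "F' \<in> \<B>" for F F'
    using square_bramble_touch[OF m k] that unfolding \<B>_def by blast
  have L: "L x = l" if "F \<in> \<B>" "x \<in> F" for F x
  proof -
    obtain y z where yz: "y \<in> F" "z \<in> F0" "y = z \<or> (y, z) \<in> parcs (grid k)"
      using touch[OF \<open>F \<in> \<B>\<close> F0] by blast
    have "L y = L z" using edge[of y z] yz F(3)[OF F0] F(3)[OF that(1)] by blast
    then show ?thesis
      using inside[OF that yz(1)] inside[OF F0 yz(2) v0] by (simp add: l_def)
  qed
  have branchF: "P v \<subseteq> pverts H \<and> conn (parcs H) (P v)" if "F \<in> \<B>" "v \<in> F" for F v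
    using branch F[OF that(1)] W that(2) by blast
  have step: "\<exists>x\<in>P u. \<exists>y\<in>P v. x = y \<or> (x, y) \<in> parcs H"
    if "F \<in> \<B>" "F' \<in> \<B>" "u \<in> F" "v \<in> F'" "u = v \<or> (u, v) \<in> parcs (grid k)" for F F' u v
  proof (cases "u = v")
    case True
    then show ?thesis using branchF[OF that(1,3)] unfolding conn_def by blast
  next
    case False
    then show ?thesis using edge[of u v] that F(3)[OF that(1)] F(3)[OF that(2)] by blast
  qed
  define U where "U F = (\<Union>v\<in>F. P v)" for F
  have "\<exists>s\<in>pverts T. \<forall>Q\<in>U ` \<B>. Q \<inter> B s \<noteq> {}"
  proof (rule bramble_bag[OF pair_graph D])
    show "U ` \<B> \<noteq> {}" using F0 by blast
    show "Q \<subseteq> pverts H \<and> conn (parcs H) Q" if "Q \<in> U ` \<B>" for Q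
    proof -
      obtain F where FQ: "F \<in> \<B>" "Q = U F" using \<open>Q \<in> U ` \<B>\<close> by blast
      have "conn (parcs H) (U F)" unfolding U_def
        by (rule conn_UN[OF F(2)[OF FQ(1)]]) (use branchF[OF FQ(1)] step[OF FQ(1) FQ(1)] in blast)+
      then show ?thesis using branchF[OF FQ(1)] unfolding FQ(2) U_def by blast
    qed
    show "\<exists>x\<in>Q. \<exists>y\<in>Q'. x = y \<or> (x, y) \<in> parcs H" if "Q \<in> U ` \<B>" "Q' \<in> U ` \<B>" for Q Q'
    proof -
      obtain F F' where FF: "F \<in> \<B>" "F' \<in> \<B>" "Q = U F" "Q' = U F'"
        using \<open>Q \<in> U ` \<B>\<close> \<open>Q' \<in> U ` \<B>\<close> by blast
      obtain u v where uv: "u \<in> F" "v \<in> F'" "u = v \<or> (u, v) \<in> parcs (grid k)"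
        using touch[OF FF(1,2)] by blast
      from step[OF FF(1,2) uv] show ?thesis using uv unfolding FF U_def by blast
    qed
  qed
  then obtain s where s: "s \<in> pverts T" "\<And>F. F \<in> \<B> \<Longrightarrow> U F \<inter> B s \<noteq> {}"
    by (metis imageI)
  \<comment> \<open>Restricting to one label makes the projections disjoint, so distinct vertices of
    \<open>Y\<close> use distinct elements of the bag.\<close>
  define Y where "Y = {v \<in> ?W - X. L v = l \<and> P v \<inter> B s \<noteq> {}}"
  have "B s \<subseteq> pverts H" using D s(1) by (simp add: tree_decomposition_def)
  then have "card Y \<le> card (B s)"
    using W by (intro card_hit_le[of _ _ l]) (auto simp: Y_def intro: finite_subset)
  then have Y: "card Y \<le> t" using t[OF s(1)] by simp
  have "m + 1 \<le> card (X \<inter> ?W \<union> Y)"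
  proof (rule square_bramble_order[OF m])
    show "finite (X \<inter> ?W \<union> Y)" by (simp add: Y_def)
    show "F \<inter> (X \<inter> ?W \<union> Y) \<noteq> {}" if sb: "F \<in> square_bramble a b m" for F
    proof (cases "F \<in> \<B>")
      case True
      then obtain v where "v \<in> F" "P v \<inter> B s \<noteq> {}" using s(2)[OF True] unfolding U_def by blast
      then have "v \<in> Y" using F[OF True] L[OF True] by (auto simp: Y_def)
      then show ?thesis using \<open>v \<in> F\<close> by blast
    next
      case False
      then show ?thesis using sb square_bramble_subset[OF m sb] unfolding \<B>_def by blast
    qed
  qed
  also have "\<dots> \<le> card (X \<inter> ?W) + t"
    using card_Un_le[of "X \<inter> ?W" Y] Y by linarith
  finally show False using small by simp
qed

lemma card_label_class_le: "card {v \<in> pverts (grid k) - X. L v = l} \<le> card (pverts H)"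
proof (rule card_hit_le[of _ _ l])
  show "L v = l \<and> P v \<inter> pverts H \<noteq> {}" if "v \<in> {v \<in> pverts (grid k) - X. L v = l}" for v
    using branch[of v] that unfolding conn_def by blast
qed auto

end

section \<open>Arithmetic of the two bounds\<close>

text \<open>Put s = sqrt n. If s \<le> t, then k^2 > 4 s^3 and hence k > 2s. But \<open>sq\<close>
  gives k^2 \<le> s^2 + s^3 + sk \<le> 2 s^3 + k^2 / 2, that is, k^2 \<le> 4 s^3.\<close>

lemma small_bound:
  fixes k n t x :: real
  assumes sq: "k\<^sup>2 - x \<le> sqrt n * (x + k)" and x: "x \<le> n" and n: "1 \<le> n"
    and k: "4 * n * t < k\<^sup>2" "0 \<le> k" "0 \<le> t"
  shows "t\<^sup>2 < n"
proof (rule ccontr)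
  assume "\<not> t\<^sup>2 < n"
  define s where "s = sqrt n"
  have s: "1 \<le> s" "s\<^sup>2 = n" using n by (auto simp: s_def)
  have "s\<^sup>2 \<le> t\<^sup>2" using \<open>\<not> t\<^sup>2 < n\<close> s(2) by linarith
  then have "s \<le> t" using k(3) by (rule power2_le_imp_le)
  then have "4 * s\<^sup>2 * s \<le> 4 * s\<^sup>2 * t" using s(1) by (intro mult_left_mono) auto
  moreover have "4 * s ^ 3 = 4 * s\<^sup>2 * s" by (simp add: power3_eq_cube power2_eq_square)
  moreover have "4 * s\<^sup>2 * t < k\<^sup>2" using k(1) s(2) by simp
  ultimately have k3: "4 * s ^ 3 < k\<^sup>2" by linarith
  have "s\<^sup>2 * 1 \<le> s\<^sup>2 * s" using s(1) by (intro mult_left_mono) auto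
  then have s23: "s\<^sup>2 \<le> s ^ 3" by (simp add: power3_eq_cube power2_eq_square)
  have "(2 * s)\<^sup>2 < k\<^sup>2" using k3 s23 by (simp add: power_mult_distrib)
  then have "2 * s < k" using k(2) by (rule power2_less_imp_less)
  then have "2 * s * k \<le> k\<^sup>2"
    unfolding power2_eq_square using k(2) by (intro mult_right_mono) auto
  moreover have "k\<^sup>2 \<le> s\<^sup>2 + s ^ 3 + s * k"
  proof -
    have "s * (x + k) \<le> s * (s\<^sup>2 + k)" using s x by (intro mult_left_mono) auto
    moreover have "s * (s\<^sup>2 + k) = s ^ 3 + s * k"
      by (simp add: power3_eq_cube power2_eq_square distrib_left)
    ultimately show ?thesis using sq x s(2) unfolding s_def[symmetric] by linarith
  qed
  ultimately have "k\<^sup>2 \<le> 4 * s ^ 3" using s23 by linarith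
  then show False using k3 by simp
qed

text \<open>Multiplied by \<open>4 * t\<close>, the tiling bound becomes k^2 - (k - 2tq)^2 + 4t (q^2
  + r^2 - qr) \<le> 4nt. Taking \<open>q\<close> nearest to k / 2t makes the square at most t^2, and
  the last term on the left compensates for it.\<close>

lemma tiling_arithmetic:
  fixes k n t x :: int
  assumes t: "1 \<le> t" and k: "4 * n * t < k\<^sup>2" "0 \<le> k" and tn: "t\<^sup>2 < n"
    and tiling: "\<And>q m r. k = q * m + r \<Longrightarrow> 1 \<le> q \<Longrightarrow> 0 \<le> r \<Longrightarrow> r < q \<Longrightarrow> 2 \<le> m \<Longrightarrow>
      q\<^sup>2 * (m + 1 - t) + r\<^sup>2 \<le> n"
  shows False
proof -
  \<comment> \<open>Rounds k / 2t with ties going down, so that k - 2tq = d - t + 1 lies between 1 -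
    t and t.\<close>
  define q where "q = (k + t - 1) div (2 * t)"
  define d where "d = (k + t - 1) mod (2 * t)"
  have d: "0 \<le> d" "d < 2 * t" using t by (auto simp: d_def)
  have kq: "k = 2 * t * q + d - t + 1"
    using mult_div_mod_eq[of "2 * t" "k + t - 1"] by (simp add: q_def d_def)
  have "4 * t\<^sup>2 * t \<le> 4 * n * t" using tn t by (intro mult_right_mono) auto
  then have t3: "4 * t ^ 3 < k\<^sup>2" using k(1) by (simp add: power3_eq_cube power2_eq_square)
  have "t\<^sup>2 * 1 \<le> t\<^sup>2 * t" using t by (intro mult_left_mono) auto
  then have "(2 * t)\<^sup>2 < k\<^sup>2" using t3 by (simp add: power3_eq_cube power2_eq_square)
  then have k2t: "2 * t < k" using k(2) by (rule power2_less_imp_less)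
  have q: "1 \<le> q"
    using k2t t zdiv_mono1[of "2 * t" "k + t - 1" "2 * t"] by (simp add: q_def)
  \<comment> \<open>Combined with 4 t^3 < k^2 this bounds t by a multiple of q^2;
    \<open>1 \<le> q\<close> allows replacing 2q + 1 by 3q.\<close>
  have "k \<le> t * (2 * q + 1)" using kq d by (simp add: algebra_simps)
  then have "k\<^sup>2 \<le> (t * (2 * q + 1))\<^sup>2" using k(2) by (rule power_mono)
  then have "t\<^sup>2 * (4 * t) < t\<^sup>2 * (2 * q + 1)\<^sup>2"
    using t3 by (simp add: power_mult_distrib power3_eq_cube power2_eq_square algebra_simps)
  then have "4 * t < (2 * q + 1)\<^sup>2" using t by (simp add: mult_less_cancel_left)
  also have "(2 * q + 1)\<^sup>2 \<le> (3 * q)\<^sup>2" using q by (intro power_mono) auto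
  finally have "4 * t < 9 * q\<^sup>2" by (simp add: power_mult_distrib)
  then have tq: "t \<le> 3 * q\<^sup>2" using zero_le_power2[of q] by linarith
  \<comment> \<open>Ensures that the windows have side at least 2, as the bramble requires.\<close>
  have "2 * q \<le> k"
  proof -
    have "0 \<le> (k - 1) * (t - 1)" using k2t t by (intro mult_nonneg_nonneg) auto
    moreover have "t * (2 * q) = k + t - 1 - d" using kq by simp
    moreover have "t * k = (k - 1) * (t - 1) + k + t - 1" by (simp add: algebra_simps)
    ultimately have "t * (2 * q) \<le> t * k" using d by linarith
    then show ?thesis using t by simp
  qed
  then have m: "2 \<le> k div q" using q zdiv_mono1[of "2 * q" k q] by simp
  define m where "m = k div q"
  define r where "r = k mod q"
  have r: "0 \<le> r" "r < q" using q by (auto simp: r_def)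
  have kmr: "k = q * m + r" by (simp add: m_def r_def)
  have n: "q\<^sup>2 * (m + 1 - t) + r\<^sup>2 \<le> n" using tiling[OF kmr q r] m by (simp add: m_def)
  have "(k - 2 * t * q)\<^sup>2 \<le> t\<^sup>2"
    using d kq by (intro abs_le_square_iff[THEN iffD1]) auto
  moreover have "t * t \<le> t * (3 * q\<^sup>2)" using tq t by (intro mult_left_mono) auto
  moreover have "t * (3 * q\<^sup>2) \<le> t * (4 * (q\<^sup>2 + r\<^sup>2 - q * r))"
  proof (intro mult_left_mono)
    \<comment> \<open>This square is exactly the difference of the two sides below.\<close>
    have "0 \<le> (q - 2 * r)\<^sup>2" by simp
    then show "3 * q\<^sup>2 \<le> 4 * (q\<^sup>2 + r\<^sup>2 - q * r)" by (simp add: power2_eq_square algebra_simps)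
  qed (use t in simp)
  moreover have "4 * t * (q\<^sup>2 * (m + 1 - t) + r\<^sup>2)
      = k\<^sup>2 - (k - 2 * t * q)\<^sup>2 + t * (4 * (q\<^sup>2 + r\<^sup>2 - q * r))"
    unfolding kmr by (simp add: power2_eq_square algebra_simps)
  moreover have "4 * t * (q\<^sup>2 * (m + 1 - t) + r\<^sup>2) \<le> 4 * t * n"
    using n t by (intro mult_left_mono) auto
  ultimately show False using k(1) by (simp add: power2_eq_square mult.commute mult.left_commute)
qed

lemma bag_cardD:
  assumes "pair_graph G" "tree_decomposition G T B"
    and t: "t = Max ((\<lambda>s. card (B s)) ` pverts T)"
  shows "s \<in> pverts T \<Longrightarrow> card (B s) \<le> t" "pverts G \<noteq> {} \<Longrightarrow> 1 \<le> t"
proof -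
  interpret G: pair_graph G by fact
  interpret T: pair_graph T
    using assms(2) by (simp add: tree_decomposition_def graph_tree_def)
  show le: "card (B s) \<le> t" if "s \<in> pverts T" for s
    unfolding t using that by (intro Max_ge) auto
  show "1 \<le> t" if ne: "pverts G \<noteq> {}"
  proof -
    obtain v where "v \<in> pverts G" using ne by blast
    then have "induces_connected T {s \<in> pverts T. v \<in> B s}"
      using assms(2) by (simp add: tree_decomposition_def)
    from connected_nonempty[OF this] obtain s where s: "s \<in> pverts T" "v \<in> B s" by blast
    have "finite (B s)"
      by (rule finite_subset[OF _ G.pair_finite_verts]) (use assms(2) s in \<open>simp add: tree_decomposition_def\<close>)
    with s have "card (B s) > 0" by (auto simp: card_gt_0_iff)
    with le[OF s(1)] show ?thesis by simp
  qed
qed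

section \<open>Grid minors of the product with a star\<close>

text \<open>Every arc of the star has \<open>c\<close> as an end, so away from the central copy only
  arcs inside one leaf copy of \<open>H\<close> remain.\<close>

lemma lex_product_off_center:
  assumes "parcs S = {c} \<times> (pverts S - {c}) \<union> (pverts S - {c}) \<times> {c}"
    and "(x, y) \<in> parcs (lex_product S H)" "fst x \<noteq> c" "fst y \<noteq> c"
  shows "fst x = fst y" "(snd x, snd y) \<in> parcs H"
  using assms(2-) by (cases x; cases y; auto simp: lex_product_def assms(1))+

lemma grid_minor_star_bound:
  assumes S: "star S" and H: "pair_graph H" and minor: "is_minor (grid k) (lex_product S H)"
    and D: "tree_decomposition H T B" and t: "t = Max ((\<lambda>s. card (B s)) ` pverts T)"
  shows "k\<^sup>2 \<le> 4 * card (pverts H) * t"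
proof (rule ccontr)
  let ?n = "card (pverts H)" and ?SH = "lex_product S H"
  assume neg: "\<not> ?thesis"
  interpret H: pair_graph H by fact
  obtain c where c: "c \<in> pverts S" and
    parcs_S: "parcs S = {c} \<times> (pverts S - {c}) \<union> (pverts S - {c}) \<times> {c}" and "pair_graph S"
    using S by (auto simp: star_def)
  then have SH: "pair_graph ?SH" using H pair_graph_lex_product by blast
  have verts: "pverts ?SH = pverts S \<times> pverts H" by (simp add: lex_product_def)
  obtain M where "(\<forall>v\<in>pverts (grid k). induces_connected ?SH (M v)) \<and>
      (\<forall>u\<in>pverts (grid k). \<forall>v\<in>pverts (grid k). u \<noteq> v \<longrightarrow> M u \<inter> M v = {}) \<and>
      (\<forall>(u, v)\<in>parcs (grid k). \<exists>x\<in>M u. \<exists>y\<in>M v. (x, y) \<in> parcs ?SH)"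
    using minor unfolding is_minor_def ..
  then have M: "\<And>v. v \<in> pverts (grid k) \<Longrightarrow> induces_connected ?SH (M v)"
    and M_disj: "\<And>u v. u \<in> pverts (grid k) \<Longrightarrow> v \<in> pverts (grid k) \<Longrightarrow> u \<noteq> v \<Longrightarrow> M u \<inter> M v = {}"
    and M_edge: "\<And>u v. (u, v) \<in> parcs (grid k) \<Longrightarrow> \<exists>x\<in>M u. \<exists>y\<in>M v. (x, y) \<in> parcs ?SH"
    by blast+
  define X where "X = {v \<in> pverts (grid k). M v \<inter> {c} \<times> pverts H \<noteq> {}}"
  \<comment> \<open>Any point of \<open>M v\<close> gives the same value when \<open>v\<close> is a
    grid vertex outside \<open>X\<close>: a connected branch set that avoids the centre cannot
    change its leaf.\<close>
  define L where "L v = fst (SOME x. x \<in> M v)" for v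
  define P where "P v = snd ` M v" for v
  have Mv: "conn (parcs ?SH) (M v)" "M v \<subseteq> pverts S \<times> pverts H" if "v \<in> pverts (grid k)" for v
    using conn_if_induces_connected[OF SH M[OF that]] M[OF that] verts
    by (auto simp: induces_connected_def)
  have off: "fst x \<noteq> c" if "v \<in> pverts (grid k) - X" "x \<in> M v" for v x
    using that Mv(2)[of v] by (cases x) (auto simp: X_def)
  have L: "fst x = L v" if v: "v \<in> pverts (grid k) - X" and x: "x \<in> M v" for v x
  proof -
    have "(SOME x. x \<in> M v) \<in> M v" using x by (rule someI)
    moreover have "fst y = fst z" if "(y, z) \<in> parcs ?SH" "y \<in> M v" "z \<in> M v" for y z
      using lex_product_off_center(1)[OF parcs_S that(1)] off[OF v] that(2,3) by blast
    ultimately show ?thesis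
      unfolding L_def using conn_const[of "parcs ?SH" "M v" fst] Mv(1)[of v] v x by blast
  qed
  interpret labelled_grid_model H k X L P
  proof unfold_locales
    show "X \<subseteq> pverts (grid k)" by (auto simp: X_def)
    show "P v \<subseteq> pverts H \<and> conn (parcs H) (P v)" if v: "v \<in> pverts (grid k) - X" for v
    proof
      show "P v \<subseteq> pverts H" using Mv(2)[of v] v by (auto simp: P_def)
      show "conn (parcs H) (P v)" unfolding P_def
        by (rule conn_image[OF Mv(1)]) (use v off[OF v] lex_product_off_center[OF parcs_S] in blast)+
    qed
    show "L u = L v \<and> (\<exists>x\<in>P u. \<exists>y\<in>P v. (x, y) \<in> parcs H)"
      if uv: "(u, v) \<in> parcs (grid k)" "u \<notin> X" "v \<notin> X" for u v
    proof -
      obtain x y where xy: "x \<in> M u" "y \<in> M v" "(x, y) \<in> parcs ?SH" using M_edge[OF uv(1)] by blast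
      have V: "u \<in> pverts (grid k) - X" "v \<in> pverts (grid k) - X"
        using uv by (auto simp: grid_def)
      note lex_product_off_center[OF parcs_S xy(3) off[OF V(1) xy(1)] off[OF V(2) xy(2)]]
      then show ?thesis using L[OF V(1) xy(1)] L[OF V(2) xy(2)] xy(1,2) by (auto simp: P_def)
    qed
    show "P u \<inter> P v = {}" if uv: "u \<in> pverts (grid k) - X" "v \<in> pverts (grid k) - X" "u \<noteq> v" "L u = L v" for u v
    proof (rule ccontr)
      assume "P u \<inter> P v \<noteq> {}"
      then obtain x y where xy: "x \<in> M u" "y \<in> M v" "snd x = snd y" by (auto simp: P_def)
      then have "x = y" using L[OF uv(1) xy(1)] L[OF uv(2) xy(2)] uv(4) by (simp add: prod_eq_iff)
      then show False using xy M_disj[of u v] uv by blast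
    qed
  qed
  \<comment> \<open>Each branch set counted by \<open>X\<close> takes its own vertex of the central
    copy.\<close>
  have X_le: "card X \<le> ?n"
  proof -
    have "card X \<le> card ({c} \<times> pverts H)"
      by (rule card_le_if_disjoint_hitting[of _ _ M]) (use M_disj in \<open>auto simp: X_def\<close>)
    then show ?thesis by (simp add: card_cartesian_product)
  qed
  \<comment> \<open>For empty \<open>H\<close> the product has no vertices, which forces
    \<open>k = 0\<close> and contradicts \<open>neg\<close>.\<close>
  have n: "1 \<le> ?n"
  proof (rule ccontr)
    assume "\<not> 1 \<le> ?n"
    then have "card (pverts H) = 0" by linarith
    then have "pverts ?SH = {}" by (simp add: verts)
    then have "card (pverts (grid k)) \<le> 0"
      using is_minor_card_le[OF SH _ minor] by (simp add: grid_def)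
    then show False using neg by (simp add: grid_def card_cartesian_product)
  qed
  have verts_grid: "pverts (grid k) = {..<k} \<times> {..<k}" by (simp add: grid_def)
  note bags = bag_cardD[OF H D t]
  have t1: "1 \<le> t" using bags(2) n by fastforce
  have k_gt: "4 * ?n * t < k\<^sup>2" using neg by simp
  have "(real t)\<^sup>2 < real ?n"
  proof (rule small_bound)
    show "(real k)\<^sup>2 - real (card X) \<le> sqrt (real ?n) * (real (card X) + real k)"
    proof (rule square_sub_card_le[OF finite_X])
      show "L u = L v" if "(u, v) \<in> parcs (grid k)" "u \<notin> X" "v \<notin> X" for u v
        using edge[OF that] ..
    qed (use X_subset card_label_class_le verts_grid in simp_all)
    show "4 * real ?n * real t < (real k)\<^sup>2"
      using k_gt by (metis of_nat_less_iff of_nat_mult of_nat_numeral of_nat_power)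
  qed (use X_le n in auto)
  then have tn: "(int t)\<^sup>2 < int ?n" by (metis of_nat_less_iff of_nat_power)
  show False
  proof (rule tiling_arithmetic[of "int t" "int ?n" "int k"])
    show "4 * int ?n * int t < (int k)\<^sup>2"
      using k_gt by (metis of_nat_less_iff of_nat_mult of_nat_numeral of_nat_power)
    fix q m r :: int
    assume qmr: "int k = q * m + r" "1 \<le> q" "0 \<le> r" "r < q" "2 \<le> m"
    have "int (nat q * nat m + nat r) = int k" using qmr by simp
    then have "k = nat q * nat m + nat r" by (simp only: of_nat_eq_iff)
    then have "(int (nat q))\<^sup>2 * (int (nat m) + 1 - int t) + (int (nat r))\<^sup>2 \<le> int (card X)"
      by (rule balanced_tiling_bound[OF finite_X])
        (use qmr card_square_inter_ge[OF D bags(1)] in auto)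
    then show "q\<^sup>2 * (m + 1 - int t) + r\<^sup>2 \<le> int ?n" using qmr X_le by simp
  qed (use t1 tn in auto)
qed

theorem theorem12:
  fixes S :: "'a pair_pre_digraph" and H :: "'b pair_pre_digraph" and n :: nat
  assumes "star S"
    and "pair_graph H" and "card (pverts H) = n"
  shows "real (gm (lex_product S H)) \<le> 2 * sqrt (real n * (real_of_int (treewidth H) + 1))"
proof -
  let ?k = "gm (lex_product S H)"
  have "pair_graph S" using assms(1) by (simp add: star_def)
  then have minor: "is_minor (grid ?k) (lex_product S H)"
    by (intro gm_attained(2) pair_graph_lex_product assms(2))
  \<comment> \<open>For an optimal decomposition the largest bag size \<open>t\<close> is the
    treewidth plus one.\<close>
  obtain T :: "nat pair_pre_digraph" and B where D: "tree_decomposition H T B"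
    and w: "decomposition_width T B = treewidth H"
    using treewidth_attained[OF assms(2)] by blast
  define t where "t = Max ((\<lambda>s. card (B s)) ` pverts T)"
  have "real_of_int (treewidth H) + 1 = real t"
    using w by (simp add: decomposition_width_def t_def flip: w)
  moreover have "?k\<^sup>2 \<le> 4 * n * t"
    using grid_minor_star_bound[OF assms(1,2) minor D t_def] assms(3) by simp
  then have "(real ?k)\<^sup>2 \<le> 4 * (real n * real t)"
    by (metis mult.assoc of_nat_le_iff of_nat_mult of_nat_numeral of_nat_power)
  then have "real ?k \<le> sqrt (4 * (real n * real t))" by (rule real_le_rsqrt)
  ultimately show ?thesis by (simp add: real_sqrt_mult)
qed

end
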